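(* Let $G$ be a connected $P_5$-free chordal bipartite graph with bipartition $(A,B)$, let $(A_1,B_1)$ be a maximum biclique of $G$ with $A_1\subseteq A$, $B_1\subseteq B$, and let $A_2=A\setminus A_1$, $B_2=B\setminus B_1$, $p=|A_2|$, $q=|B_2|$. Then $G$ has a Hamiltonian cycle if and only if (i) $|A|=|B|$, and (ii) $A_2$ has an ordering $(u_1,\dots,u_p)$ such that $d(u_g)>g$ for all $1\le g\le p$, and $B_2$ has an ordering $(v_1,\dots,v_q)$ such that $d(v_h)>h$ for all $1\le h\le q$.
   Context: Graphs are finite, simple and undirected. A bipartite graph is chordal bipartite if every cycle of length at least six has a chord. $P_5$-free means no induced path on five vertices. $d(v)$ is the degree of $v$ in $G$. A biclique is a pair $(X,Y)$ with $X\subseteq A$, $Y\subseteq B$ such that every vertex of $X$ is adjacent to every vertex of $Y$; it is maximal if no vertex can be added to $X$ or to $Y$ keeping this property. Following the paper, a maximum biclique is a maximal biclique $(X,Y)$ for which $\bigl||X|-|Y|\bigr|$ is minimum.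
   Formalization: The graph G is assumed not to have exactly two vertices, because for the single edge K_2 conditions (i) and (ii) hold (A_2 and B_2 are empty) although K_2 has no Hamiltonian cycle. *)

theory Defs
  imports Main
begin

definition simple_graph :: "'a set \<Rightarrow> 'a set set \<Rightarrow> bool" where
  "simple_graph V E \<longleftrightarrow> finite V \<and> (\<forall>e\<in>E. e \<subseteq> V \<and> card e = 2)"

abbreviation adjacent :: "'a set set \<Rightarrow> 'a \<Rightarrow> 'a \<Rightarrow> bool" where
  "adjacent E u v \<equiv> {u, v} \<in> E"

definition degree :: "'a set set \<Rightarrow> 'a \<Rightarrow> nat" where
  "degree E v = card {w. adjacent E v w}"

(* Walks, paths and cycles are lists of vertices; the closing edge of a cycle joins the last
   vertex of the list to the first, which is not repeated. *)

definition is_walk :: "'a set \<Rightarrow> 'a set set \<Rightarrow> 'a list \<Rightarrow> bool" where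
  "is_walk V E xs \<longleftrightarrow> xs \<noteq> [] \<and> set xs \<subseteq> V \<and>
     (\<forall>i. Suc i < length xs \<longrightarrow> adjacent E (xs ! i) (xs ! Suc i))"

definition connected_graph :: "'a set \<Rightarrow> 'a set set \<Rightarrow> bool" where
  "connected_graph V E \<longleftrightarrow> V \<noteq> {} \<and>
     (\<forall>u\<in>V. \<forall>v\<in>V. \<exists>xs. is_walk V E xs \<and> hd xs = u \<and> last xs = v)"

definition is_induced_path :: "'a set \<Rightarrow> 'a set set \<Rightarrow> 'a list \<Rightarrow> bool" where
  "is_induced_path V E xs \<longleftrightarrow> set xs \<subseteq> V \<and> distinct xs \<and>
     (\<forall>i j. i < j \<and> j < length xs \<longrightarrow> (adjacent E (xs ! i) (xs ! j) \<longleftrightarrow> j = Suc i))"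

definition induced_path_free :: "nat \<Rightarrow> 'a set \<Rightarrow> 'a set set \<Rightarrow> bool" where
  "induced_path_free n V E \<longleftrightarrow> \<not> (\<exists>xs. length xs = n \<and> is_induced_path V E xs)"

definition cycle_edges :: "'a list \<Rightarrow> 'a set set" where
  "cycle_edges xs = {{xs ! i, xs ! (Suc i mod length xs)} | i. i < length xs}"

definition is_cycle :: "'a set \<Rightarrow> 'a set set \<Rightarrow> 'a list \<Rightarrow> bool" where
  "is_cycle V E xs \<longleftrightarrow> 3 \<le> length xs \<and> distinct xs \<and> set xs \<subseteq> V \<and> cycle_edges xs \<subseteq> E"

definition has_chord :: "'a set set \<Rightarrow> 'a list \<Rightarrow> bool" where
  "has_chord E xs \<longleftrightarrow> (\<exists>e\<in>E. e \<subseteq> set xs \<and> e \<notin> cycle_edges xs)"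

definition has_hamiltonian_cycle :: "'a set \<Rightarrow> 'a set set \<Rightarrow> bool" where
  "has_hamiltonian_cycle V E \<longleftrightarrow> (\<exists>xs. is_cycle V E xs \<and> set xs = V)"

definition is_bipartition :: "'a set \<Rightarrow> 'a set set \<Rightarrow> 'a set \<Rightarrow> 'a set \<Rightarrow> bool" where
  "is_bipartition V E A B \<longleftrightarrow> A \<union> B = V \<and> A \<inter> B = {} \<and> (\<forall>e\<in>E. \<exists>a\<in>A. \<exists>b\<in>B. e = {a, b})"

definition chordal_bipartite :: "'a set \<Rightarrow> 'a set set \<Rightarrow> bool" where
  "chordal_bipartite V E \<longleftrightarrow> (\<exists>A B. is_bipartition V E A B) \<and>
     (\<forall>xs. is_cycle V E xs \<and> 6 \<le> length xs \<longrightarrow> has_chord E xs)"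

definition is_biclique :: "'a set set \<Rightarrow> 'a set \<Rightarrow> 'a set \<Rightarrow> 'a set \<Rightarrow> 'a set \<Rightarrow> bool" where
  "is_biclique E A B X Y \<longleftrightarrow> X \<subseteq> A \<and> Y \<subseteq> B \<and> (\<forall>x\<in>X. \<forall>y\<in>Y. adjacent E x y)"

definition is_maximal_biclique :: "'a set set \<Rightarrow> 'a set \<Rightarrow> 'a set \<Rightarrow> 'a set \<Rightarrow> 'a set \<Rightarrow> bool" where
  "is_maximal_biclique E A B X Y \<longleftrightarrow> is_biclique E A B X Y \<and>
     (\<forall>a\<in>A - X. \<not> is_biclique E A B (insert a X) Y) \<and>
     (\<forall>b\<in>B - Y. \<not> is_biclique E A B X (insert b Y))"

(* "Maximum" here means most balanced among the maximal bicliques, not largest. *)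

definition is_maximum_biclique :: "'a set set \<Rightarrow> 'a set \<Rightarrow> 'a set \<Rightarrow> 'a set \<Rightarrow> 'a set \<Rightarrow> bool" where
  "is_maximum_biclique E A B X Y \<longleftrightarrow> is_maximal_biclique E A B X Y \<and>
     (\<forall>X' Y'. is_maximal_biclique E A B X' Y' \<longrightarrow>
        \<bar>int (card X) - int (card Y)\<bar> \<le> \<bar>int (card X') - int (card Y')\<bar>)"

end

theory Submission
  imports Defs
begin

text \<open>A connected \<open>P\<^sub>5\<close>-free bipartite graph contains no induced \<open>2K\<^sub>2\<close>, so the neighbourhoods on each
  side form a chain. If \<open>a\<^sub>1, \<dots>, a\<^sub>n\<close> lists \<open>A\<close> by increasing degree and \<open>b\<^sub>1, \<dots>, b\<^sub>n\<close> lists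
  \<open>B\<close> by decreasing degree, then \<open>a\<^sub>i\<close> is adjacent to exactly the first \<open>d(a\<^sub>i)\<close> of the \<open>b\<^sub>j\<close>.
  Hence \<open>b\<^sub>1 a\<^sub>1 b\<^sub>2 a\<^sub>2 \<dots> b\<^sub>n a\<^sub>n\<close> is a Hamiltonian cycle as soon as \<open>d(a\<^sub>k) > k\<close> for all
  \<open>k < n\<close>. For \<open>a\<^sub>k \<in> A\<^sub>2\<close> this is a count of the low-degree vertices of \<open>A\<^sub>2\<close>; for \<open>a\<^sub>k \<in> A\<^sub>1\<close>
  the non-neighbours of \<open>a\<^sub>k\<close> lie in \<open>B\<^sub>2\<close> and have degree at most \<open>n - k\<close>, so the ordering of
  \<open>B\<^sub>2\<close> bounds their number. Conversely, on a Hamiltonian cycle a nonempty proper subset of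
  \<open>A\<close> has more neighbours than elements.\<close>

section \<open>Sorting finite sets and counting vertices of low degree\<close>

lemma finite_sort_by:
  fixes d :: "'a \<Rightarrow> 'b::linorder"
  assumes "finite A"
  obtains f where "bij_betw f {..<card A} A"
    and "\<And>i j. i \<le> j \<Longrightarrow> j < card A \<Longrightarrow> d (f i) \<le> d (f j)"
proof -
  obtain xs where xs: "set xs = A" "distinct xs"
    using finite_distinct_list[OF assms] by blast
  define ys where "ys = sort_key d xs"
  have ys: "set ys = A" "distinct ys" "length ys = card A" "sorted (map d ys)"
    using xs distinct_card[OF xs(2)] by (auto simp: ys_def)
  show ?thesis
  proof (rule that)
    show "bij_betw ((!) ys) {..<card A} A"
      using bij_betw_nth[OF ys(2)] ys by auto
    show "d (ys ! i) \<le> d (ys ! j)" if "i \<le> j" "j < card A" for i j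
      using sorted_nth_mono[OF ys(4), of i j] that ys(3) by simp
  qed
qed

text \<open>An element \<open>u g\<close> with \<open>d (u g) \<le> m\<close> has
  \<open>g < d (u g) \<le> m\<close>, so it occupies one of the first \<open>m - 1\<close>
  positions. The orderings of \<open>A - A1\<close> and \<open>B - B1\<close> enter the sufficiency
  proof only through this count.\<close>

lemma card_below_ordering_bound:
  fixes d :: "'a \<Rightarrow> nat"
  assumes u: "bij_betw u {1..p} S" and gt: "\<forall>g. 1 \<le> g \<and> g \<le> p \<longrightarrow> d (u g) > g"
    and "m \<ge> 1"
  shows "card {x \<in> S. d x \<le> m} < m"
proof -
  have "{x \<in> S. d x \<le> m} \<subseteq> u ` {1..<m}"
  proof
    fix x assume x: "x \<in> {x \<in> S. d x \<le> m}"
    then obtain g where g: "g \<in> {1..p}" "x = u g"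
      using u by (auto simp: bij_betw_def)
    with gt x have "g < m" by fastforce
    with g show "x \<in> u ` {1..<m}" by auto
  qed
  then have "card {x \<in> S. d x \<le> m} \<le> card {1..<m}"
    by (meson card_image_le card_mono finite_atLeastLessThan finite_imageI le_trans)
  with \<open>m \<ge> 1\<close> show ?thesis by simp
qed

lemma is_bipartition_swap: "is_bipartition V E A B \<Longrightarrow> is_bipartition V E B A"
  unfolding is_bipartition_def by (metis Int_commute Un_commute insert_commute)

lemma bipartite_adjacent:
  assumes "is_bipartition V E A B" "a \<in> A" "adjacent E a b"
  shows "b \<in> B"
proof -
  obtain x y where "x \<in> A" "y \<in> B" "{a, b} = {x, y}"
    using assms unfolding is_bipartition_def by blast
  with assms show ?thesis
    by (auto simp: is_bipartition_def doubleton_eq_iff)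
qed

lemma is_biclique_swap: "is_biclique E A B X Y \<longleftrightarrow> is_biclique E B A Y X"
  unfolding is_biclique_def by (metis insert_commute)

lemma is_maximal_biclique_swap:
  "is_maximal_biclique E A B X Y \<Longrightarrow> is_maximal_biclique E B A Y X"
  unfolding is_maximal_biclique_def by (metis is_biclique_swap)

section \<open>Chain graphs and their nested neighbourhoods\<close>

locale chain_graph =
  fixes V :: "'a set" and E :: "'a set set" and A B :: "'a set"
  assumes finite_V: "finite V"
    and bipartition: "is_bipartition V E A B"
    and no_2K2: "\<And>a b a' b'. a \<in> A \<Longrightarrow> a' \<in> A \<Longrightarrow> adjacent E a b \<Longrightarrow> adjacent E a' b' \<Longrightarrow>
      adjacent E a b' \<or> adjacent E a' b"
begin

lemma V_eq: "V = A \<union> B" and disjoint: "A \<inter> B = {}"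
  using bipartition unfolding is_bipartition_def by auto

lemma finite_A: "finite A" and finite_B: "finite B"
  using finite_V by (simp_all add: V_eq)

lemma adj_A: "a \<in> A \<Longrightarrow> adjacent E a b \<Longrightarrow> b \<in> B"
  using bipartite_adjacent[OF bipartition] .

lemma adj_B: "b \<in> B \<Longrightarrow> adjacent E b a \<Longrightarrow> a \<in> A"
  using bipartite_adjacent[OF is_bipartition_swap[OF bipartition]] .

lemma swap: "chain_graph V E B A"
proof
  show "finite V" by (rule finite_V)
  show "is_bipartition V E B A" by (rule is_bipartition_swap[OF bipartition])
  fix a b a' b'
  assume "a \<in> B" "a' \<in> B" "adjacent E a b" "adjacent E a' b'"
  then show "adjacent E a b' \<or> adjacent E a' b"
    using no_2K2[of b b' a a'] adj_B[of a b] adj_B[of a' b'] by (auto simp: insert_commute)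
qed

lemma finite_nbhd: "a \<in> A \<Longrightarrow> finite {w. adjacent E a w}"
  by (rule finite_subset[OF _ finite_B]) (auto dest: adj_A)

text \<open>Incomparable neighbourhoods would provide two independent edges, contrary to
  \<open>no_2K2\<close>. Once they are comparable, the degrees decide the direction.\<close>

lemma nbhd_mono:
  assumes "a \<in> A" "a' \<in> A" "degree E a \<le> degree E a'"
  shows "{w. adjacent E a w} \<subseteq> {w. adjacent E a' w}"
proof -
  have "\<forall>w w'. adjacent E a w \<longrightarrow> adjacent E a' w' \<longrightarrow> adjacent E a w' \<or> adjacent E a' w"
    using no_2K2[OF assms(1,2)] by simp
  then consider "{w. adjacent E a w} \<subseteq> {w. adjacent E a' w}"
    | "{w. adjacent E a' w} \<subseteq> {w. adjacent E a w}"
    by auto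
  then show ?thesis
  proof cases
    case 2
    have "{w. adjacent E a' w} = {w. adjacent E a w}"
      by (rule card_seteq[OF finite_nbhd[OF assms(1)] 2]) (use assms(3) in \<open>simp add: degree_def\<close>)
    then show ?thesis by simp
  qed
qed

text \<open>If \<open>a\<close> misses \<open>g j\<close>, it misses every later \<open>g i\<close>
  as well, since the neighbours of \<open>g i\<close> are neighbours of \<open>g j\<close>. So all
  neighbours of \<open>a\<close> are among the first \<open>j\<close> vertices, and its degree is at
  most \<open>j\<close>.\<close>

lemma adjacent_if_degree_gt:
  assumes g: "bij_betw g {..<card B} B"
    and desc: "\<And>i j. i \<le> j \<Longrightarrow> j < card B \<Longrightarrow> degree E (g j) \<le> degree E (g i)"
    and "a \<in> A" "j < card B" "j < degree E a"
  shows "adjacent E a (g j)"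
proof (rule ccontr)
  assume nadj: "\<not> adjacent E a (g j)"
  have gB: "g i \<in> B" if "i < card B" for i
    using g that by (auto simp: bij_betw_def)
  have "{w. adjacent E a w} \<subseteq> g ` {..<j}"
  proof
    fix w assume w: "w \<in> {w. adjacent E a w}"
    then obtain i where i: "i < card B" "w = g i"
      using adj_A[OF \<open>a \<in> A\<close>] g by (auto simp: bij_betw_def)
    have "i < j"
    proof (rule ccontr)
      assume "\<not> i < j"
      then have "degree E (g i) \<le> degree E (g j)"
        using desc i by simp
      then have "adjacent E (g j) a"
        using chain_graph.nbhd_mono[OF swap gB[OF i(1)] gB[OF assms(4)]] w i
        by (auto simp: insert_commute)
      with nadj show False by (simp add: insert_commute)
    qed
    with i show "w \<in> g ` {..<j}" by auto
  qed
  then have "degree E a \<le> card {..<j}"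
    unfolding degree_def
    by (meson card_image_le card_mono finite_imageI finite_lessThan le_trans)
  with assms(5) show False by simp
qed

section \<open>Sufficiency: building the cycle\<close>

text \<open>Indices start at 0, so \<open>f k\<close> must reach both \<open>g k\<close> and
  \<open>g (Suc k)\<close>, which takes degree at least \<open>k + 2\<close>. The last vertex needs
  only \<open>g (n - 1)\<close> and \<open>g 0\<close>, hence the restriction to
  \<open>Suc k < n\<close>.\<close>

lemma hamiltonian_if_degrees_gt:
  assumes f: "bij_betw f {..<n} A"
    and asc: "\<And>i j. i \<le> j \<Longrightarrow> j < n \<Longrightarrow> degree E (f i) \<le> degree E (f j)"
    and deg: "\<And>k. Suc k < n \<Longrightarrow> degree E (f k) > Suc k"
    and "card B = n" "n \<ge> 2"
  shows "has_hamiltonian_cycle V E"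
proof -
  \<comment> \<open>The key is negated, over the integers, to sort \<open>B\<close> by decreasing
    degree.\<close>
  obtain g where g: "bij_betw g {..<n} B"
    and g_desc: "\<And>i j. i \<le> j \<Longrightarrow> j < n \<Longrightarrow> - int (degree E (g i)) \<le> - int (degree E (g j))"
    using finite_sort_by[OF finite_B, of "\<lambda>b. - int (degree E b)"] \<open>card B = n\<close> by metis
  have fA: "f i \<in> A" and gB: "g i \<in> B" if "i < n" for i
    using f g that by (auto simp: bij_betw_def)
  have adj: "adjacent E (f i) (g j)" if "i < n" "j < n" "j < degree E (f i)" for i j
    using adjacent_if_degree_gt[of g "f i" j] g g_desc fA that \<open>card B = n\<close> by auto
  have last_deg: "degree E (f (n - 1)) \<ge> n"
  \<comment> \<open>The last vertex inherits its bound from the one before it: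
    \<open>f (n - 2)\<close> already has degree above \<open>n - 1\<close>.\<close>
  proof -
    obtain m where "n = Suc (Suc m)"
      using \<open>n \<ge> 2\<close> by (metis add_2_eq_Suc le_Suc_ex)
    then show ?thesis using asc[of m "Suc m"] deg[of m] by simp
  qed
  have adj_same: "adjacent E (f k) (g k)" if "k < n" for k
  proof (cases "Suc k < n")
    case True
    then show ?thesis using adj[of k k] deg[of k] by simp
  next
    case False
    with that have "k = n - 1" by simp
    then show ?thesis using adj[of k k] last_deg that by simp
  qed
  have adj_next: "adjacent E (f k) (g (Suc k))" if "Suc k < n" for k
    using adj[of k "Suc k"] deg[of k] that by simp
  have adj_close: "adjacent E (f (n - 1)) (g 0)"
    using adj[of "n - 1" 0] last_deg \<open>n \<ge> 2\<close> by simp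
  define c where "c k = (if even k then g (k div 2) else f (k div 2))" for k :: nat
  define xs where "xs = map c [0..<2 * n]"
  have len: "length xs = 2 * n" and nth: "\<And>i. i < 2 * n \<Longrightarrow> xs ! i = c i"
    by (auto simp: xs_def)
  have "inj_on c {..<2 * n}"
  proof (rule inj_onI)
    fix i j assume ij: "i \<in> {..<2 * n}" "j \<in> {..<2 * n}" "c i = c j"
    then have lt: "i div 2 < n" "j div 2 < n" by auto
    have par: "even i = even j"
    proof -
      have "f (i div 2) \<noteq> g (j div 2)" "g (i div 2) \<noteq> f (j div 2)"
        using fA gB lt disjoint by (metis disjoint_iff)+
      then show ?thesis using ij(3) by (auto simp: c_def split: if_splits)
    qed
    have "i div 2 = j div 2"
    proof (cases "even i")
      case True
      then have "g (i div 2) = g (j div 2)" using ij(3) par by (simp add: c_def)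
      then show ?thesis using lt inj_onD[OF bij_betw_imp_inj_on[OF g]] by simp
    next
      case False
      then have "f (i div 2) = f (j div 2)" using ij(3) par by (simp add: c_def)
      then show ?thesis using lt inj_onD[OF bij_betw_imp_inj_on[OF f]] by simp
    qed
    with par show "i = j" by presburger
  qed
  then have dist: "distinct xs"
    by (simp add: xs_def distinct_map atLeast0LessThan)
  have set_xs: "set xs = V"
  proof
    show "set xs \<subseteq> V"
      using fA gB by (auto simp: xs_def c_def V_eq)
    have "f k = c (2 * k + 1)" "g k = c (2 * k)" for k
      by (auto simp: c_def)
    then have "f k \<in> set xs" "g k \<in> set xs" if "k < n" for k
      using that unfolding xs_def by (auto intro!: image_eqI)
    moreover have "A = f ` {..<n}" "B = g ` {..<n}"
      using f g by (auto simp: bij_betw_def)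
    ultimately show "V \<subseteq> set xs"
      unfolding V_eq by auto
  qed
  have "cycle_edges xs \<subseteq> E"
  proof
    fix e assume "e \<in> cycle_edges xs"
    then obtain i where i: "i < 2 * n" "e = {xs ! i, xs ! (Suc i mod (2 * n))}"
      by (auto simp: cycle_edges_def len)
    then have e: "e = {c i, c (Suc i mod (2 * n))}"
      by (simp add: nth)
    show "e \<in> E"
    proof (cases "even i")
      case True
      then obtain k where k: "i = 2 * k" by blast
      then have "e = {g k, f k}" using e i by (simp add: c_def)
      then show ?thesis using adj_same[of k] i k by (simp add: insert_commute)
    next
      case False
      then obtain k where k: "i = 2 * k + 1" by (blast elim: oddE)
      show ?thesis
      proof (cases "Suc k < n")
        case True
        then have "e = {f k, g (Suc k)}" using e k by (simp add: c_def)
        then show ?thesis using adj_next[OF True] by simp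
      next
        case False
        then have kn: "k = n - 1" "Suc i = 2 * n" using i k by auto
        have "c i = f k" using k by (simp add: c_def)
        then have "e = {f (n - 1), g 0}" using e kn by (simp add: c_def)
        then show ?thesis using adj_close by simp
      qed
    qed
  qed
  then have "is_cycle V E xs"
    using len dist set_xs \<open>n \<ge> 2\<close> by (simp add: is_cycle_def)
  then show ?thesis
    using set_xs unfolding has_hamiltonian_cycle_def by blast
qed

theorem hamiltonian_if_orderings:
  assumes max: "is_maximal_biclique E A B A1 B1"
    and u: "bij_betw u {1..p} (A - A1)" "\<forall>g. 1 \<le> g \<and> g \<le> p \<longrightarrow> degree E (u g) > g"
    and v: "bij_betw v {1..q} (B - B1)" "\<forall>h. 1 \<le> h \<and> h \<le> q \<longrightarrow> degree E (v h) > h"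
    and card: "card A = n" "card B = n" "n \<ge> 2"
  shows "has_hamiltonian_cycle V E"
proof -
  obtain f where f: "bij_betw f {..<n} A"
    and asc: "\<And>i j. i \<le> j \<Longrightarrow> j < n \<Longrightarrow> degree E (f i) \<le> degree E (f j)"
    using finite_sort_by[OF finite_A, of "degree E"] unfolding card(1) by blast
  have fA: "f i \<in> A" if "i < n" for i
    using f that by (auto simp: bij_betw_def)
  have nbhd_f: "{w. adjacent E (f i) w} \<subseteq> {w. adjacent E (f j) w}" if "i \<le> j" "j < n" for i j
    using nbhd_mono[OF fA fA asc] that by simp
  have biclique: "is_biclique E A B A1 B1"
    using max by (simp add: is_maximal_biclique_def)
  have "degree E (f k) > Suc k" if k: "Suc k < n" for k
  proof (rule ccontr)
    assume low: "\<not> degree E (f k) > Suc k"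
    show False
    proof (cases "f k \<in> A1")
      \<comment> \<open>By maximality \<open>f k\<close> misses some \<open>b\<close> in
        \<open>B1\<close>. So does every \<open>f i\<close> with \<open>i \<le> k\<close>, and these
        \<open>k + 1\<close> vertices of degree at most \<open>k + 1\<close> all lie outside
        \<open>A1\<close>: too many for the ordering \<open>u\<close>.\<close>
      case False
      have "f ` {..k} \<subseteq> {x \<in> A - A1. degree E x \<le> Suc k}"
      proof
        fix x assume "x \<in> f ` {..k}"
        then obtain i where i: "i \<le> k" "x = f i" by auto
        have "\<not> is_biclique E A B (insert (f k) A1) B1"
          using max fA[of k] k False by (simp add: is_maximal_biclique_def)
        then obtain b where b: "b \<in> B1" "\<not> adjacent E (f k) b"
          using biclique fA[of k] k by (auto simp: is_biclique_def)
        then have "\<not> adjacent E (f i) b"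
          using nbhd_f[of i k] i k by auto
        then have "f i \<notin> A1"
          using b(1) biclique by (auto simp: is_biclique_def)
        then show "x \<in> {x \<in> A - A1. degree E x \<le> Suc k}"
          using i k fA[of i] asc[of i k] low by auto
      qed
      then have "card (f ` {..k}) \<le> card {x \<in> A - A1. degree E x \<le> Suc k}"
        using finite_A by (intro card_mono finite_subset[OF _ finite_A]) simp_all
      moreover have "{..k} \<subseteq> {..<n}"
        using k by auto
      then have "card (f ` {..k}) = Suc k"
        using card_image[OF inj_on_subset[OF bij_betw_imp_inj_on[OF f]]] by simp
      ultimately show False
        using card_below_ordering_bound[OF u, of "Suc k"] by simp
    next
      \<comment> \<open>Now \<open>f k\<close> misses only vertices outside \<open>B1\<close>. A
        missed vertex is also missed by every earlier \<open>f i\<close>, so its degree is at most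
        \<open>?m\<close>. The ordering \<open>v\<close> allows fewer than \<open>?m\<close> such
        vertices, whereas the low degree of \<open>f k\<close> forces at least
        \<open>?m\<close>.\<close>
      case True
      let ?N = "{w. adjacent E (f k) w}" and ?m = "n - Suc k"
      have "B - ?N \<subseteq> {x \<in> B - B1. degree E x \<le> ?m}"
      proof
        fix b assume b: "b \<in> B - ?N"
        then have "b \<notin> B1"
          using biclique True by (auto simp: is_biclique_def)
        have "{w. adjacent E b w} \<subseteq> f ` {Suc k..<n}"
        proof
          fix w assume w: "w \<in> {w. adjacent E b w}"
          then obtain i where i: "i < n" "w = f i"
            using adj_B[of b w] b f by (auto simp: bij_betw_def)
          have "\<not> i \<le> k"
          proof
            assume "i \<le> k"
            then have "b \<in> ?N"
              using nbhd_f[of i k] i w k by (auto simp: insert_commute)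
            with b show False by simp
          qed
          with i show "w \<in> f ` {Suc k..<n}" by auto
        qed
        then have "card {w. adjacent E b w} \<le> card {Suc k..<n}"
          by (meson card_image_le card_mono finite_atLeastLessThan finite_imageI le_trans)
        with b \<open>b \<notin> B1\<close> show "b \<in> {x \<in> B - B1. degree E x \<le> ?m}"
          by (simp add: degree_def)
      qed
      then have "card (B - ?N) \<le> card {x \<in> B - B1. degree E x \<le> ?m}"
        using finite_B by (intro card_mono finite_subset[OF _ finite_B]) simp_all
      also have "\<dots> < ?m"
        using card_below_ordering_bound[OF v, of ?m] k by simp
      finally have "card (B - ?N) < ?m" .
      moreover have "?m \<le> card (B - ?N)"
        using diff_card_le_card_Diff[OF finite_nbhd[OF fA[of k]], of B] low k card
        by (simp add: degree_def)
      ultimately show False by simp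
    qed
  qed
  then show ?thesis
    using hamiltonian_if_degrees_gt[OF f asc] card by blast
qed

end

section \<open>Hamiltonian cycles as cyclic permutations\<close>

text \<open>The map \<sigma> moves each vertex one place along the cycle. The third property says
  that \<sigma> has a single orbit, which distinguishes a Hamiltonian cycle from a union of disjoint
  cycles.\<close>

lemma hamiltonian_cycle_successor:
  assumes "has_hamiltonian_cycle V E"
  obtains \<sigma> where "bij_betw \<sigma> V V" and "\<And>x. x \<in> V \<Longrightarrow> adjacent E x (\<sigma> x)"
    and "\<And>T. T \<subseteq> V \<Longrightarrow> T \<noteq> {} \<Longrightarrow> \<sigma> ` T \<subseteq> T \<Longrightarrow> T = V"
proof -
  obtain xs where cyc: "is_cycle V E xs" and set_xs: "set xs = V"
    using assms unfolding has_hamiltonian_cycle_def by blast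
  define m where "m = length xs"
  have m: "m > 0" and dist: "distinct xs" and edges: "cycle_edges xs \<subseteq> E"
    using cyc by (auto simp: is_cycle_def m_def)
  have nth: "bij_betw ((!) xs) {..<m} V"
    using bij_betw_nth[OF dist] set_xs m_def by auto
  define idx where "idx = the_inv_into {..<m} ((!) xs)"
  have idx: "idx (xs ! i) = i" if "i < m" for i
    using nth that unfolding idx_def by (intro the_inv_into_f_f) (auto simp: bij_betw_def)
  define \<sigma> where "\<sigma> x = xs ! (Suc (idx x) mod m)" for x
  have \<sigma>: "\<sigma> (xs ! i) = xs ! (Suc i mod m)" if "i < m" for i
    using idx[OF that] by (simp add: \<sigma>_def)
  have V: "V = (!) xs ` {..<m}"
    using nth by (simp add: bij_betw_def)
  have finV: "finite V"
    using set_xs by auto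
  have "V \<subseteq> \<sigma> ` V"
  proof
    fix x assume "x \<in> V"
    then obtain j where j: "j < m" "x = xs ! j" using V by auto
    define i where "i = (if j = 0 then m - 1 else j - 1)"
    have "i < m" "Suc i mod m = j"
      using j m by (auto simp: i_def)
    then show "x \<in> \<sigma> ` V"
      using \<sigma>[of i] j V by (auto intro!: image_eqI[of _ _ "xs ! i"])
  qed
  moreover have "\<sigma> ` V \<subseteq> V"
    using \<sigma> m V by auto
  ultimately have img: "\<sigma> ` V = V" by blast
  show ?thesis
  proof (rule that[of \<sigma>])
    show "bij_betw \<sigma> V V"
      using img eq_card_imp_inj_on[OF finV, of \<sigma>] by (simp add: bij_betw_def)
    show "adjacent E x (\<sigma> x)" if x: "x \<in> V" for x
    proof -
      obtain i where i: "i < m" "x = xs ! i" using x V by auto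
      then have "{x, \<sigma> x} \<in> cycle_edges xs"
        using \<sigma> by (auto simp: cycle_edges_def m_def)
      with edges show ?thesis by blast
    qed
    show "T = V" if T: "T \<subseteq> V" "T \<noteq> {}" "\<sigma> ` T \<subseteq> T" for T
    proof -
      obtain i where i: "i < m" "xs ! i \<in> T" using T V by auto
      have step: "xs ! ((i + k) mod m) \<in> T" for k
      proof (induction k)
        case 0
        with i show ?case by simp
      next
        case (Suc k)
        then have "\<sigma> (xs ! ((i + k) mod m)) \<in> T" using T by blast
        then show ?case using \<sigma>[of "(i + k) mod m"] m by (simp add: mod_Suc_eq)
      qed
      \<comment> \<open>From position \<open>i\<close>, going \<open>m - i + j\<close> places
        forward leads to \<open>m + j\<close>, which wraps around to \<open>j\<close>; the detour
        avoids a truncated \<open>j - i\<close>.\<close>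
      have "xs ! j \<in> T" if "j < m" for j
        using step[of "m - i + j"] i that by simp
      with V T show ?thesis by auto
    qed
  qed
qed

text \<open>The successor map sends each side injectively into the other.\<close>

lemma hamiltonian_card_eq:
  assumes "has_hamiltonian_cycle V E" "is_bipartition V E A B" "finite V"
  shows "card A = card B"
proof -
  obtain \<sigma> where bij: "bij_betw \<sigma> V V" and adj: "\<And>x. x \<in> V \<Longrightarrow> adjacent E x (\<sigma> x)"
    using hamiltonian_cycle_successor[OF assms(1)] by metis
  have le: "card X \<le> card Y" if "is_bipartition V E X Y" for X Y
  proof (rule card_inj_on_le)
    show "inj_on \<sigma> X"
      using bij that by (auto simp: bij_betw_def is_bipartition_def intro: inj_on_subset)
    show "finite Y"
      using that assms(3) by (auto simp: is_bipartition_def)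
    show "\<sigma> ` X \<subseteq> Y"
    proof
      fix y assume "y \<in> \<sigma> ` X"
      then obtain x where x: "x \<in> X" "y = \<sigma> x" by blast
      then have "adjacent E x y" using adj that by (auto simp: is_bipartition_def)
      with x that show "y \<in> Y" by (metis bipartite_adjacent)
    qed
  qed
  from le[OF assms(2)] le[OF is_bipartition_swap[OF assms(2)]] show ?thesis by simp
qed

section \<open>Necessity: neighbourhood sizes on a Hamiltonian cycle\<close>

context chain_graph
begin

text \<open>Successors and predecessors of \<open>S\<close> both lie in \<open>N\<close>. If
  \<open>N\<close> were no larger than \<open>S\<close>, each of these sets would be all of
  \<open>N\<close>, so \<sigma> would exchange \<open>S\<close> and \<open>N\<close>. The single
  orbit would then be \<open>S \<union> N\<close>, forcing \<open>S = A\<close>.\<close>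

lemma hamiltonian_nbhd_card:
  assumes "has_hamiltonian_cycle V E" and S: "S \<subset> A" "S \<noteq> {}"
    and N: "finite N" "\<And>x w. x \<in> S \<Longrightarrow> adjacent E x w \<Longrightarrow> w \<in> N" "N \<subseteq> B"
  shows "card S < card N"
proof (rule ccontr)
  assume le: "\<not> card S < card N"
  obtain \<sigma> where bij: "bij_betw \<sigma> V V" and adj: "\<And>x. x \<in> V \<Longrightarrow> adjacent E x (\<sigma> x)"
    and orbit: "\<And>T. T \<subseteq> V \<Longrightarrow> T \<noteq> {} \<Longrightarrow> \<sigma> ` T \<subseteq> T \<Longrightarrow> T = V"
    using hamiltonian_cycle_successor[OF assms(1)] by metis
  have inj: "inj_on \<sigma> V" and surj: "\<sigma> ` V = V"
    using bij by (auto simp: bij_betw_def)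
  have SV: "S \<subseteq> V" using S V_eq by blast
  have finS: "finite S" using SV finite_V finite_subset by blast
  have "\<sigma> ` S \<subseteq> N" using N(2)[OF _ adj] SV by auto
  moreover have "card (\<sigma> ` S) = card S"
    using inj SV by (intro card_image) (rule inj_on_subset)
  ultimately have img: "\<sigma> ` S = N"
    using card_seteq[OF N(1)] le by simp
  define P where "P = {x \<in> V. \<sigma> x \<in> S}"
  have \<sigma>P: "\<sigma> ` P = S"
    using surj SV unfolding P_def by auto
  have "P \<subseteq> N"
  proof
    fix x assume "x \<in> P"
    then have "\<sigma> x \<in> S" "adjacent E (\<sigma> x) x"
      using adj[of x] by (auto simp: P_def insert_commute)
    then show "x \<in> N" by (rule N(2))
  qed
  moreover have "inj_on \<sigma> P"
    using inj by (rule inj_on_subset) (auto simp: P_def)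
  then have "card P = card S"
    using card_image \<sigma>P by metis
  ultimately have "P = N"
    using card_seteq[OF N(1)] le by simp
  then have "\<sigma> ` (S \<union> N) \<subseteq> S \<union> N"
    using img \<sigma>P by auto
  then have "S \<union> N = V"
    using SV S(2) N(3) V_eq by (intro orbit) auto
  then have "A \<subseteq> S" using N(3) V_eq disjoint by auto
  with S(1) show False by auto
qed

text \<open>A biclique may have an empty side, so this needs an argument: a vertex of maximum degree
  in \<open>A\<close> sees all of \<open>B\<close>, because every vertex of \<open>B\<close> has a
  neighbour, and could be added to an empty \<open>A1\<close>. It makes \<open>A - A1\<close> a
  proper subset of \<open>A\<close>, as \<open>hamiltonian_nbhd_card\<close> requires.\<close>

lemma maximal_biclique_nonempty:
  assumes ham: "has_hamiltonian_cycle V E" and max: "is_maximal_biclique E A B A1 B1"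
  shows "A1 \<noteq> {}"
proof
  assume empty: "A1 = {}"
  obtain \<sigma> where adj: "\<And>x. x \<in> V \<Longrightarrow> adjacent E x (\<sigma> x)"
    using hamiltonian_cycle_successor[OF ham] by metis
  have B1: "B1 \<subseteq> B"
    using max by (simp add: is_maximal_biclique_def is_biclique_def)
  have "V \<noteq> {}"
    using ham by (auto simp: has_hamiltonian_cycle_def is_cycle_def)
  then obtain x where "x \<in> V" by auto
  then have "A \<noteq> {}" using adj_B[of x, OF _ adj[of x]] V_eq by auto
  then have "Max (degree E ` A) \<in> degree E ` A"
    using finite_A by (intro Max_in) auto
  then obtain a where a: "a \<in> A" "degree E a = Max (degree E ` A)" by auto
  have a_max: "degree E x \<le> degree E a" if "x \<in> A" for x
    using that finite_A a(2) by simp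
  have "adjacent E a b" if b: "b \<in> B" for b
  proof -
    have ab: "adjacent E b (\<sigma> b)" "\<sigma> b \<in> A"
      using adj[of b] adj_B[OF b] b V_eq by auto
    then show ?thesis
      using nbhd_mono[OF ab(2) a(1) a_max[OF ab(2)]] by (auto simp: insert_commute)
  qed
  then have "is_biclique E A B (insert a A1) B1"
    using B1 a empty by (auto simp: is_biclique_def)
  with max a empty show False by (auto simp: is_maximal_biclique_def)
qed

text \<open>Increasing degree is a suitable order: the first \<open>g\<close> vertices have all
  their neighbours inside the neighbourhood of \<open>u g\<close>, which must therefore have more
  than \<open>g\<close> elements.\<close>

theorem ordering_if_hamiltonian:
  assumes ham: "has_hamiltonian_cycle V E" and max: "is_maximal_biclique E A B A1 B1"
    and p: "p = card (A - A1)"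
  shows "\<exists>u. bij_betw u {1..p} (A - A1) \<and> (\<forall>g. 1 \<le> g \<and> g \<le> p \<longrightarrow> degree E (u g) > g)"
proof -
  have A1: "A1 \<subseteq> A" "A1 \<noteq> {}"
    using max maximal_biclique_nonempty[OF ham max]
    by (auto simp: is_maximal_biclique_def is_biclique_def)
  obtain f where f: "bij_betw f {..<p} (A - A1)"
    and asc: "\<And>i j. i \<le> j \<Longrightarrow> j < p \<Longrightarrow> degree E (f i) \<le> degree E (f j)"
    using finite_sort_by[of "A - A1" "degree E"] finite_A p by auto
  \<comment> \<open>Shifts the sorted enumeration from indices starting at 0 to indices starting at
    1.\<close>
  define u where "u = f \<circ> (\<lambda>g. g - 1)"
  have "bij_betw (\<lambda>g. g - 1) {1..p} {..<p}"
    by (rule bij_betw_byWitness[where f' = Suc]) auto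
  from bij_betw_trans[OF this f] have bij: "bij_betw u {1..p} (A - A1)"
    by (simp add: u_def)
  have "degree E (u g) > g" if g: "1 \<le> g" "g \<le> p" for g
  proof -
    have fA: "f i \<in> A - A1" if "i < p" for i
      using f that by (auto simp: bij_betw_def)
    let ?S = "f ` {..<g}" and ?N = "{w. adjacent E (u g) w}"
    have ug: "u g \<in> A" using fA[of "g - 1"] g by (simp add: u_def)
    have "?S \<subseteq> A - A1" using fA g by auto
    then have S: "?S \<subset> A" using A1 by blast
    have "?S \<noteq> {}" using g by (auto simp: lessThan_empty_iff)
    have N: "w \<in> ?N" if xw: "x \<in> ?S" "adjacent E x w" for x w
    proof -
      obtain i where i: "i < g" "x = f i" using xw(1) by auto
      have "degree E x \<le> degree E (u g)"
        using asc[of i "g - 1"] i g by (simp add: u_def)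
      then show ?thesis
        using nbhd_mono[of x "u g"] xw S ug by auto
    qed
    have "card ?S < card ?N"
      by (rule hamiltonian_nbhd_card[OF ham S \<open>?S \<noteq> {}\<close> finite_nbhd[OF ug] N]) (auto dest: adj_A[OF ug])
    moreover have "{..<g} \<subseteq> {..<p}"
      using g by auto
    then have "card ?S = g"
      using card_image[OF inj_on_subset[OF bij_betw_imp_inj_on[OF f]]] by simp
    ultimately show ?thesis by (simp add: degree_def)
  qed
  with bij show ?thesis by blast
qed

end

section \<open>From connected \<open>P\<^sub>5\<close>-free bipartite graphs to chain graphs\<close>

lemma is_walk_closed:
  assumes "is_walk V E xs" "hd xs \<in> T" and closed: "\<And>x y. x \<in> T \<Longrightarrow> adjacent E x y \<Longrightarrow> y \<in> T"
  shows "last xs \<in> T"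
proof -
  have "xs ! i \<in> T" if "i < length xs" for i
    using that
  proof (induction i)
    case 0
    with assms show ?case by (simp add: hd_conv_nth)
  next
    case (Suc i)
    with assms(1) closed show ?case unfolding is_walk_def by (meson Suc_lessD)
  qed
  with assms(1) show ?thesis by (simp add: is_walk_def last_conv_nth)
qed

text \<open>In a bipartite graph the path \<open>x1 y1 x2 y2 x3\<close> can only have the chords
  \<open>x1 y2\<close> and \<open>x3 y1\<close>. The sides \<open>X\<close> and \<open>Y\<close> are
  kept general so that the path may start on either side.\<close>

lemma induced_P5:
  assumes bip: "is_bipartition V E X Y" and free: "induced_path_free 5 V E"
    and "adjacent E x1 y1" "adjacent E y1 x2" "adjacent E x2 y2" "adjacent E y2 x3"
    and "x1 \<in> X" "x2 \<in> X" "x3 \<in> X" "y1 \<in> Y" "y2 \<in> Y"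
  shows "adjacent E x1 y2 \<or> adjacent E x3 y1"
proof (rule ccontr)
  assume no: "\<not> ?thesis"
  let ?xs = "[x1, y1, x2, y2, x3]"
  have V: "X \<union> Y = V" and disj: "X \<inter> Y = {}"
    using bip unfolding is_bipartition_def by auto
  have nX: "\<not> adjacent E x x'" if "x \<in> X" "x' \<in> X" for x x'
    using bipartite_adjacent[OF bip that(1)] that(2) disj by blast
  have nY: "\<not> adjacent E y y'" if "y \<in> Y" "y' \<in> Y" for y y'
    using bipartite_adjacent[OF is_bipartition_swap[OF bip] that(1)] that(2) disj by blast
  \<comment> \<open>Any coincidence within a side would turn a path edge into one of the two
    excluded chords; for instance \<open>x1 = x3\<close> makes \<open>x1\<close> adjacent to
    \<open>y2\<close>.\<close>
  have dist: "distinct ?xs"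
    using no assms(3-) disj by (auto simp: insert_commute)
  have nonadj: "\<not> adjacent E x1 x2" "\<not> adjacent E x1 y2" "\<not> adjacent E x1 x3"
    "\<not> adjacent E y1 y2" "\<not> adjacent E y1 x3" "\<not> adjacent E x2 x3"
    using no assms(7-) nX nY by (auto simp: insert_commute)
  have "adjacent E (?xs ! i) (?xs ! j) \<longleftrightarrow> j = Suc i" if "i < j" "j < length ?xs" for i j
  proof -
    have "j = 1 \<and> i = 0 \<or> j = 2 \<and> (i = 0 \<or> i = 1) \<or> j = 3 \<and> (i = 0 \<or> i = 1 \<or> i = 2) \<or>
      j = 4 \<and> (i = 0 \<or> i = 1 \<or> i = 2 \<or> i = 3)"
      using that by simp arith
    then show ?thesis
      by (elim disjE conjE) (simp_all add: assms(3-6) nonadj)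
  qed
  then have "is_induced_path V E ?xs"
    unfolding is_induced_path_def using dist V assms(7-) by auto
  moreover have "length ?xs = 5" by simp
  ultimately show False
    using free
    unfolding induced_path_free_def by blast
qed

text \<open>In a \<open>P\<^sub>5\<close>-free bipartite graph, having a common neighbour is a transitive relation on each
  side; by connectedness any two vertices of one side have a common neighbour, which joins two
  independent edges to an induced \<open>P\<^sub>5\<close>.\<close>

lemma connected_P5_free_chain_graph:
  assumes "finite V" and conn: "connected_graph V E" and free: "induced_path_free 5 V E"
    and bip: "is_bipartition V E A B"
  shows "chain_graph V E A B"
proof
  show "finite V" "is_bipartition V E A B" by fact+
  fix a b a' b'
  assume a: "a \<in> A" "a' \<in> A" and ab: "adjacent E a b" "adjacent E a' b'"
  have V: "A \<union> B = V" and disj: "A \<inter> B = {}"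
    using bip unfolding is_bipartition_def by auto
  have adjA: "y \<in> B" if "x \<in> A" "adjacent E x y" for x y
    using bipartite_adjacent[OF bip that] .
  have adjB: "x \<in> A" if "y \<in> B" "adjacent E y x" for x y
    using bipartite_adjacent[OF is_bipartition_swap[OF bip] that] .
  define R where "R = {x \<in> A. \<exists>y. adjacent E a y \<and> adjacent E y x}"
  have aR: "a \<in> R" using a ab by (auto simp: R_def insert_commute)
  have R_step: "z \<in> R" if x: "x \<in> R" and xz: "adjacent E x y" "adjacent E y z" for x y z
  proof -
    obtain c where c: "adjacent E a c" "adjacent E c x" "x \<in> A" using x by (auto simp: R_def)
    have y: "y \<in> B" using adjA[OF c(3) xz(1)] .
    have z: "z \<in> A" using adjB[OF y xz(2)] .
    \<comment> \<open>Applied to the path \<open>a c x y z\<close>: either chord gives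
      \<open>a\<close> and \<open>z\<close> a common neighbour, \<open>y\<close> or
      \<open>c\<close>.\<close>
    have "adjacent E a y \<or> adjacent E z c"
      using induced_P5[OF bip free c(1,2) xz a(1) c(3) z adjA[OF a(1) c(1)] y] .
    then show ?thesis
    proof
      assume "adjacent E a y"
      with xz(2) z show ?thesis unfolding R_def by blast
    next
      assume "adjacent E z c"
      then have "adjacent E c z" by (simp add: insert_commute)
      with c(1) z show ?thesis unfolding R_def by blast
    qed
  qed
  \<comment> \<open>\<open>R\<close> together with its neighbours is closed under adjacency, so the
    walk from \<open>a\<close> to \<open>a'\<close> cannot leave it.\<close>
  define T where "T = R \<union> {y \<in> B. \<exists>x\<in>R. adjacent E x y}"
  have RA: "x \<in> A" if "x \<in> R" for x using that by (simp add: R_def)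
  have closed: "y \<in> T" if xy: "x \<in> T" "adjacent E x y" for x y
  proof (cases "x \<in> R")
    case True
    then have "y \<in> B" using adjA[OF RA xy(2)] by simp
    with True xy(2) show ?thesis unfolding T_def by blast
  next
    case False
    then obtain w where "w \<in> R" "adjacent E w x" using xy(1) by (auto simp: T_def)
    then have "y \<in> R" using R_step xy(2) by blast
    then show ?thesis by (simp add: T_def)
  qed
  obtain xs where "is_walk V E xs" "hd xs = a" "last xs = a'"
    using conn a V unfolding connected_graph_def by (metis UnI1)
  then have "a' \<in> T"
    using is_walk_closed[of V E xs T, OF _ _ closed] aR by (simp add: T_def)
  then obtain c where c: "adjacent E a c" "adjacent E c a'"
    using a disj by (auto simp: T_def R_def)
  have "adjacent E b a" "adjacent E b' a'"
    using ab by (simp_all add: insert_commute)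
  \<comment> \<open>The path is now \<open>b a c a' b'\<close>, with its ends in \<open>B\<close>;
    its two possible chords are exactly the adjacencies wanted.\<close>
  then have "adjacent E b a' \<or> adjacent E b' a"
    using induced_P5[OF is_bipartition_swap[OF bip] free _ c ab(2)] a adjA[OF a(1)] adjA[OF a(2)] ab c(1)
    by blast
  then show "adjacent E a b' \<or> adjacent E a' b"
    by (auto simp: insert_commute)
qed

text \<open>The assumption \<open>not_K2\<close> excludes a single edge: there \<open>A2\<close> and
  \<open>B2\<close> are empty and the right-hand side holds vacuously, but a cycle has at least
  three vertices.\<close>

theorem theorem2:
  fixes V :: "'a set" and E :: "'a set set" and A B A1 B1 A2 B2 :: "'a set" and p q :: nat
  assumes "simple_graph V E"
    and "connected_graph V E"
    and "induced_path_free 5 V E"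
    and "chordal_bipartite V E"
    and "is_bipartition V E A B"
    and "is_maximum_biclique E A B A1 B1"
    and "A2 = A - A1" and "B2 = B - B1"
    and "p = card A2" and "q = card B2"
    and not_K2: "card V \<noteq> 2"
  shows "has_hamiltonian_cycle V E \<longleftrightarrow>
    card A = card B \<and>
    ((\<exists>u. bij_betw u {1..p} A2 \<and> (\<forall>g. 1 \<le> g \<and> g \<le> p \<longrightarrow> degree E (u g) > g)) \<and>
     (\<exists>v. bij_betw v {1..q} B2 \<and> (\<forall>h. 1 \<le> h \<and> h \<le> q \<longrightarrow> degree E (v h) > h)))"
proof -
  interpret chain_graph V E A B
    using connected_P5_free_chain_graph assms(1-5) unfolding simple_graph_def by blast
  interpret swapped: chain_graph V E B A by (rule swap)
  have max: "is_maximal_biclique E A B A1 B1"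
    using assms(6) by (simp add: is_maximum_biclique_def)
  show ?thesis
  proof
    assume ham: "has_hamiltonian_cycle V E"
    show "card A = card B \<and>
      ((\<exists>u. bij_betw u {1..p} A2 \<and> (\<forall>g. 1 \<le> g \<and> g \<le> p \<longrightarrow> degree E (u g) > g)) \<and>
       (\<exists>v. bij_betw v {1..q} B2 \<and> (\<forall>h. 1 \<le> h \<and> h \<le> q \<longrightarrow> degree E (v h) > h)))"
      using hamiltonian_card_eq[OF ham bipartition finite_V] ordering_if_hamiltonian[OF ham max]
        swapped.ordering_if_hamiltonian[OF ham is_maximal_biclique_swap[OF max]] assms(7-10)
      by simp
  next
    assume rhs: "card A = card B \<and>
      ((\<exists>u. bij_betw u {1..p} A2 \<and> (\<forall>g. 1 \<le> g \<and> g \<le> p \<longrightarrow> degree E (u g) > g)) \<and>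
       (\<exists>v. bij_betw v {1..q} B2 \<and> (\<forall>h. 1 \<le> h \<and> h \<le> q \<longrightarrow> degree E (v h) > h)))"
    have "card V = card A + card B"
      unfolding V_eq by (rule card_Un_disjoint[OF finite_A finite_B disjoint])
    moreover have "card V \<noteq> 0"
      using assms(2) finite_V by (simp add: connected_graph_def)
    moreover have "card A = card B"
      using rhs by simp
    ultimately have "card B \<ge> 2" using not_K2 by arith
    with rhs show "has_hamiltonian_cycle V E"
      using hamiltonian_if_orderings[OF max] assms(7,8) by blast
  qed
qed

end
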